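(* Let $\mathcal C=\{\underline uG:\underline u\in\mathbb F_2^k\}$ be a binary linear block code of length $n$ and dimension $k\ge1$ with generator matrix $G\in\mathbb F_2^{k\times n}$, used with BPSK over an AWGN channel with noise variance $\sigma^2>0$ per component. Let $A_{i,d}$ be the number of codewords $\underline c=\underline uG$ with $W_H(\underline u)=i$ and $W_H(\underline c)=d$, and let $A_d=\sum_iA_{i,d}$. For $1\le d\le n$ and $0\le d^*\le n$ define $$\hat i_d=\max\{i: A_{i,d}>0\},\qquad A'_d=\sum_i\frac ik A_{i,d},$$ $$h'(A_d)=\min\Big\{A'_d\,Q(\sqrt d/\sigma)\,B(p_b,n-d,0,d^*-1),\ \ \frac{\hat i_d}{k}\Big((A_d-1)\big(Q(\sqrt d/\sigma)-\tfrac12Q^2(\sqrt d/\sigma)\big)B(p_b,n-2d,0,d^*-1)+Q(\sqrt d/\sigma)\Big)\Big\},$$ with $\hat i_d=0$ if $A_d=0$. Then the bit-error probability $P_b$ of the decoding algorithm that minimizes the bit-error probability satisfies $$P_b\le\min_{0\le d^*\le n}\Big\{\sum_{1\le d\le\min(2d^*,n)}h'(A_d)+B(p_b,n,d^*+1,n)\Big\}.$$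
   Context: Channel: the information vector $\underline U$ is uniformly distributed on $\mathbb F_2^k$ and encoded as $\underline c=\underline UG$; codewords are mapped by $\phi:\mathbb F_2^n\to\{-1,+1\}^n$, $\phi(\underline v)_t=1-2v_t$; the received vector is $\underline y=\phi(\underline c)+\underline z$, with $\underline z$ having i.i.d. $\mathcal N(0,\sigma^2)$ components, independent of $\underline U$. A decoder maps $\underline y$ (possibly with randomization) to $\hat{\underline U}\in\mathbb F_2^k$; its bit-error probability is $\frac1k\sum_{0\le i\le k-1}\Pr\{\hat U_i\ne U_i\}$. $P_b$ is the minimum of this quantity over all decoders. $W_H$ is Hamming weight. Notation: $Q(x)=\int_x^{\infty}\frac1{\sqrt{2\pi}}e^{-z^2/2}\,dz$; $p_b=Q(1/\sigma)$ (a channel crossover probability, not to be confused with $P_b$); $B(p,N_t,N_\ell,N_u)=\sum_{m=N_\ell}^{N_u}\binom{N_t}{m}p^m(1-p)^{N_t-m}$, i.e. the probability that a Binomial$(N_t,p)$ variable lies in $[N_\ell,N_u]$. Conventions: empty sums are $0$, terms with $m>N_t$ are $0$, and a negative $N_t$ is read as $N_t=0$. *)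

theory Defs
  imports "HOL-Probability.Probability" "HOL-Library.Z2"
begin

section \<open>Binary linear codes\<close>

instance bit :: finite
proof
  have "(UNIV :: bit set) = {0, 1}"
    by (auto intro: bit.exhaust)
  then show "finite (UNIV :: bit set)"
    by (metis finite.emptyI finite.insertI)
qed

definition hamming_weight :: "bit ^ 'a \<Rightarrow> nat" where
  "hamming_weight v = card {t. v $ t \<noteq> 0}"

definition code :: "bit ^ 'n ^ 'k \<Rightarrow> (bit ^ 'n) set" where
  "code G = range (\<lambda>u. u v* G)"

definition io_weight :: "bit ^ 'n ^ 'k \<Rightarrow> nat \<Rightarrow> nat \<Rightarrow> nat" where
  "io_weight G i d =
     card {c. \<exists>u. c = u v* G \<and> hamming_weight u = i \<and> hamming_weight c = d}"

definition weight_enum :: "bit ^ 'n ^ 'k \<Rightarrow> nat \<Rightarrow> nat" where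
  "weight_enum G d = (\<Sum>i\<le>CARD('k). io_weight G i d)"

definition max_input_weight :: "bit ^ 'n ^ 'k \<Rightarrow> nat \<Rightarrow> nat" where
  "max_input_weight G d =
     (if weight_enum G d = 0 then 0 else Max {i. io_weight G i d > 0})"

definition bit_weight_enum :: "bit ^ 'n ^ 'k \<Rightarrow> nat \<Rightarrow> real" where
  "bit_weight_enum G d = (\<Sum>i\<le>CARD('k). real i / real CARD('k) * real (io_weight G i d))"

section \<open>BPSK over the AWGN channel\<close>

definition bpsk :: "bit ^ 'n \<Rightarrow> real ^ 'n" where
  "bpsk v = (\<chi> t. if v $ t = 0 then 1 else - 1)"

text \<open>The parameter \<open>\<sigma>\<close> is the standard deviation of each noise component.\<close>

definition awgn :: "real \<Rightarrow> (real ^ 'n) measure" where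
  "awgn \<sigma> = distr (Pi\<^sub>M UNIV (\<lambda>_. density lborel (normal_density 0 \<sigma>))) borel (\<lambda>z. \<chi> t. z t)"

text \<open>
  A randomized decoder is a Markov kernel: \<open>D y\<close> is the distribution of the decoded information
  vector given the received vector \<open>y\<close>. Deterministic decoders are the kernels whose values are
  point masses.
\<close>

definition decoders :: "(real ^ 'n \<Rightarrow> (bit ^ 'k) measure) set" where
  "decoders = measurable borel (prob_algebra (count_space UNIV))"

text \<open>
  The joint distribution of the uniform information vector and the decoded one. The noise is drawn
  independently of the information vector, and the decoder sees the received vector only.
\<close>

definition transmission ::
  "bit ^ 'n ^ 'k \<Rightarrow> real \<Rightarrow> (real ^ 'n \<Rightarrow> (bit ^ 'k) measure) \<Rightarrow> ((bit ^ 'k) \<times> (bit ^ 'k)) measure"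
where
  "transmission G \<sigma> D =
     uniform_count_measure UNIV \<bind> (\<lambda>u.
       awgn \<sigma> \<bind> (\<lambda>z.
         D (bpsk (u v* G) + z) \<bind> (\<lambda>v.
           return (count_space UNIV) (u, v))))"

definition bit_error_prob ::
  "bit ^ 'n ^ 'k \<Rightarrow> real \<Rightarrow> (real ^ 'n \<Rightarrow> (bit ^ 'k) measure) \<Rightarrow> real"
where
  "bit_error_prob G \<sigma> D =
     (\<Sum>i\<in>UNIV. measure (transmission G \<sigma> D) {(u, v). v $ i \<noteq> u $ i}) / real CARD('k)"

definition min_bit_error_prob :: "bit ^ 'n ^ 'k \<Rightarrow> real \<Rightarrow> real" where
  "min_bit_error_prob G \<sigma> = (INF D\<in>decoders. bit_error_prob G \<sigma> D)"

lemma prob_space_awgn: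
  assumes "\<sigma> > 0"
  shows "prob_space (awgn \<sigma> :: (real ^ 'n) measure)"
proof -
  have "prob_space (Pi\<^sub>M (UNIV :: 'n set) (\<lambda>_. density lborel (normal_density 0 \<sigma>)))"
    using assms by (intro prob_space_PiM prob_space_normal_density)
  then show ?thesis
    unfolding awgn_def
  proof (rule prob_space.prob_space_distr)
    show "(\<lambda>z. \<chi> t. z t) \<in> Pi\<^sub>M (UNIV :: 'n set) (\<lambda>_. density lborel (normal_density 0 \<sigma>)) \<rightarrow>\<^sub>M borel"
      by (subst borel_measurable_euclidean_space)
         (auto simp: Basis_vec_def inner_axis intro!: borel_measurable_inner)
  qed
qed

lemma sets_awgn [simp, measurable_cong]: "sets (awgn \<sigma>) = sets borel"
  by (simp add: awgn_def)

lemma measure_transmission: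
  fixes G :: "bit ^ 'n ^ 'k"
  assumes "\<sigma> > 0" and D: "D \<in> decoders"
  shows "prob_space (transmission G \<sigma> D)"
    and "sets (transmission G \<sigma> D) = UNIV"
    and "emeasure (transmission G \<sigma> D) A =
      (\<Sum>u\<in>UNIV. ennreal (1 / CARD(bit ^ 'k)) * (\<integral>\<^sup>+z. emeasure (D (bpsk (u v* G) + z)) {v. (u, v) \<in> A} \<partial>awgn \<sigma>))"
proof -
  have Dm[measurable]: "D \<in> borel \<rightarrow>\<^sub>M prob_algebra (count_space UNIV)"
    using D by (simp add: decoders_def)
  have U: "uniform_count_measure (UNIV :: (bit ^ 'k) set) \<in> space (prob_algebra (count_space UNIV))"
    by (auto simp: space_prob_algebra sets_uniform_count_measure intro!: prob_space_uniform_count_measure)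
  have W: "(awgn \<sigma> :: (real ^ 'n) measure) \<in> space (prob_algebra borel)"
    using prob_space_awgn[OF assms(1)] by (simp add: space_prob_algebra)
  have k1: "(\<lambda>v. return (count_space UNIV) (u, v)) \<in> count_space UNIV \<rightarrow>\<^sub>M prob_algebra (count_space UNIV)" for u :: "bit ^ 'k"
    by (auto simp: space_prob_algebra prob_space_return)
  have k2: "(\<lambda>z. D (bpsk (u v* G) + z) \<bind> (\<lambda>v. return (count_space UNIV) (u, v)))
      \<in> borel \<rightarrow>\<^sub>M prob_algebra (count_space UNIV)" for u :: "bit ^ 'k"
    by (rule measurable_bind_prob_space[OF _ k1]) measurable
  have k3: "(\<lambda>u. awgn \<sigma> \<bind> (\<lambda>z. D (bpsk (u v* G) + z) \<bind> (\<lambda>v. return (count_space UNIV) (u, v))))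
      \<in> count_space UNIV \<rightarrow>\<^sub>M prob_algebra (count_space UNIV)"
    using prob_space_bind'[OF W k2] sets_bind'[OF W k2]
    by (simp add: space_prob_algebra)
  show "prob_space (transmission G \<sigma> D)"
    unfolding transmission_def by (rule prob_space_bind'[OF U k3])
  show "sets (transmission G \<sigma> D) = UNIV"
    unfolding transmission_def using sets_bind'[OF U k3] by simp
  have in_D: "D y \<in> space (prob_algebra (count_space UNIV))" for y
    using Dm by (rule measurable_space) simp
  have e: "emeasure (D y \<bind> (\<lambda>v. return (count_space UNIV) (u, v))) A = emeasure (D y) {v. (u, v) \<in> A}" for y u
  proof -
    have s: "sets (D y) = UNIV" using in_D[of y] by (simp add: space_prob_algebra)
    have "emeasure (D y \<bind> (\<lambda>v. return (count_space UNIV) (u, v))) A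
        = (\<integral>\<^sup>+v. indicator A (u, v) \<partial>D y)"
      by (subst emeasure_bind_prob_algebra[OF in_D k1]) auto
    also have "\<dots> = (\<integral>\<^sup>+v. indicator {v. (u, v) \<in> A} v \<partial>D y)"
      by (intro nn_integral_cong) (auto simp: indicator_def)
    also have "\<dots> = emeasure (D y) {v. (u, v) \<in> A}"
      by (rule nn_integral_indicator) (simp add: s)
    finally show ?thesis .
  qed
  have "emeasure (transmission G \<sigma> D) A =
    (\<integral>\<^sup>+u. (\<integral>\<^sup>+z. emeasure (D (bpsk (u v* G) + z)) {v. (u, v) \<in> A} \<partial>awgn \<sigma>) \<partial>uniform_count_measure UNIV)"
    unfolding transmission_def
    by (subst emeasure_bind_prob_algebra[OF U k3], simp, subst emeasure_bind_prob_algebra[OF W k2]) (auto simp: e)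
  also have "\<dots> = (\<Sum>u\<in>UNIV. ennreal (1 / CARD(bit ^ 'k)) * (\<integral>\<^sup>+z. emeasure (D (bpsk (u v* G) + z)) {v. (u, v) \<in> A} \<partial>awgn \<sigma>))"
    unfolding uniform_count_measure_def by (subst nn_integral_point_measure_finite) auto
  finally show "emeasure (transmission G \<sigma> D) A =
      (\<Sum>u\<in>UNIV. ennreal (1 / CARD(bit ^ 'k)) * (\<integral>\<^sup>+z. emeasure (D (bpsk (u v* G) + z)) {v. (u, v) \<in> A} \<partial>awgn \<sigma>))" .
qed

text \<open>The infimum defining \<open>min_bit_error_prob\<close> is a minimum: bitwise maximum a posteriori
  decoding attains it.\<close>

lemma min_bit_error_prob_attained:
  fixes G :: "bit ^ 'n ^ 'k"
  assumes "\<sigma> > 0"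
  shows "\<exists>D\<in>decoders. bit_error_prob G \<sigma> D = min_bit_error_prob G \<sigma> \<and>
    (\<forall>D'\<in>decoders. bit_error_prob G \<sigma> D \<le> bit_error_prob G \<sigma> D')"
proof -
  define P where "P u = distr (awgn \<sigma>) borel (\<lambda>z. bpsk (u v* G) + z)" for u :: "bit ^ 'k"
  define N where "N = uniform_count_measure UNIV \<bind> P"
  have PP: "prob_space (P u)" for u
    unfolding P_def by (rule prob_space.prob_space_distr[OF prob_space_awgn[OF assms]]) measurable
  have Pk: "P \<in> count_space UNIV \<rightarrow>\<^sub>M prob_algebra borel"
    using PP by (auto simp: space_prob_algebra P_def)
  have U: "uniform_count_measure (UNIV :: (bit ^ 'k) set) \<in> space (prob_algebra (count_space UNIV))"
    by (auto simp: space_prob_algebra sets_uniform_count_measure intro!: prob_space_uniform_count_measure)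
  interpret N: prob_space N
    unfolding N_def by (rule prob_space_bind'[OF U Pk])
  have sN[measurable_cong, simp]: "sets N = sets borel"
    unfolding N_def by (rule sets_bind'[OF U Pk])
  have eN: "emeasure N A = (\<Sum>u\<in>UNIV. ennreal (1 / CARD(bit ^ 'k)) * emeasure (P u) A)"
    if "A \<in> sets borel" for A
    unfolding N_def
    by (subst emeasure_bind_prob_algebra[OF U Pk that])
      (simp add: uniform_count_measure_def nn_integral_point_measure_finite)
  have ac: "absolutely_continuous N (P u)" for u
    unfolding absolutely_continuous_def null_sets_def
    by (auto simp: eN P_def)
  have sP: "sets (P u) = sets N" for u
    by (simp add: P_def)
  define g where "g u = RN_deriv N (P u)" for u
  have g[measurable]: "g u \<in> borel_measurable borel" for u
    using borel_measurable_RN_deriv[of N "P u"] by (simp add: g_def cong: measurable_cong_sets)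
  define S where "S b i y = (\<Sum>u\<in>{u. u $ i = b}. g u y)" for b :: bit and i y
  have S[measurable]: "S b i \<in> borel_measurable borel" for b i
    unfolding S_def by measurable
  define c where "c = ennreal (1 / CARD(bit ^ 'k))"
  have pt: "(\<Sum>u\<in>UNIV. g u y * emeasure (D y) {v. v $ i \<noteq> u $ i})
      = S 0 i y * emeasure (D y) {v. v $ i \<noteq> 0} + S 1 i y * emeasure (D y) {v. v $ i \<noteq> 1}"
    for D :: "real ^ 'n \<Rightarrow> (bit ^ 'k) measure" and i y
  proof -
    have "(UNIV :: (bit ^ 'k) set) = {u. u $ i = 0} \<union> {u. u $ i = 1}"
      using bit_not_zero_iff by auto
    then have "(\<Sum>u\<in>UNIV. g u y * emeasure (D y) {v. v $ i \<noteq> u $ i})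
      = (\<Sum>u\<in>{u. u $ i = 0}. g u y * emeasure (D y) {v. v $ i \<noteq> u $ i})
        + (\<Sum>u\<in>{u. u $ i = 1}. g u y * emeasure (D y) {v. v $ i \<noteq> u $ i})"
      by (rule subst[where P = "\<lambda>X. sum _ X = _", OF sym]) (rule sum.union_disjoint; auto)
    then show ?thesis
      by (simp add: S_def sum_distrib_right)
  qed
  have err: "ennreal (measure (transmission G \<sigma> D) {(u, v). v $ i \<noteq> u $ i})
      = c * (\<integral>\<^sup>+y. S 0 i y * emeasure (D y) {v. v $ i \<noteq> 0} + S 1 i y * emeasure (D y) {v. v $ i \<noteq> 1} \<partial>N)"
    if D: "D \<in> decoders" for D i
  proof -
    have [measurable]: "D \<in> borel \<rightarrow>\<^sub>M subprob_algebra (count_space UNIV)"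
      using D by (auto simp: decoders_def intro: measurable_prob_algebraD)
    interpret T: prob_space "transmission G \<sigma> D"
      by (rule measure_transmission[OF assms D])
    have "ennreal (measure (transmission G \<sigma> D) {(u, v). v $ i \<noteq> u $ i})
      = emeasure (transmission G \<sigma> D) {(u, v). v $ i \<noteq> u $ i}"
      by (simp add: T.emeasure_eq_measure)
    also have "\<dots> = (\<Sum>u\<in>UNIV. c * (\<integral>\<^sup>+z. emeasure (D (bpsk (u v* G) + z)) {v. v $ i \<noteq> u $ i} \<partial>awgn \<sigma>))"
      by (simp add: measure_transmission[OF assms D] c_def)
    also have "\<dots> = (\<Sum>u\<in>UNIV. c * (\<integral>\<^sup>+y. emeasure (D y) {v. v $ i \<noteq> u $ i} \<partial>P u))"
      unfolding P_def by (subst nn_integral_distr) (auto simp: measurable_emeasure_subprob_algebra)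
    also have "\<dots> = (\<Sum>u\<in>UNIV. c * (\<integral>\<^sup>+y. g u y * emeasure (D y) {v. v $ i \<noteq> u $ i} \<partial>N))"
      unfolding g_def by (subst N.RN_deriv_nn_integral[OF ac sP]) auto
    also have "\<dots> = c * (\<integral>\<^sup>+y. (\<Sum>u\<in>UNIV. g u y * emeasure (D y) {v. v $ i \<noteq> u $ i}) \<partial>N)"
      by (subst nn_integral_sum) (auto simp: sum_distrib_left)
    finally show ?thesis
      by (simp only: pt)
  qed
  define f where "f y = ((\<chi> i. if S 0 i y \<le> S 1 i y then 1 else 0) :: bit ^ 'k)" for y
  define M where "M y = return (count_space UNIV) (f y)" for y
  have f: "f \<in> borel \<rightarrow>\<^sub>M count_space UNIV"
  proof (subst measurable_count_space_eq2, simp, safe)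
    fix a
    have "f -` {a} \<inter> space borel = {y\<in>space borel. \<forall>i. (S 0 i y \<le> S 1 i y) = (a $ i = 1)}"
      by (auto simp: f_def vec_eq_iff split: if_splits)
    also have "\<dots> \<in> sets borel"
      by measurable
    finally show "f -` {a} \<inter> space borel \<in> sets borel" .
  qed auto
  have M: "M \<in> decoders"
    unfolding M_def decoders_def
    by (rule measurable_compose[OF f]) (rule measurable_return_prob_space)
  have le: "measure (transmission G \<sigma> M) {(u, v). v $ i \<noteq> u $ i}
      \<le> measure (transmission G \<sigma> D) {(u, v). v $ i \<noteq> u $ i}" if D: "D \<in> decoders" for D i
  proof -
    have "S 0 i y * emeasure (M y) {v. v $ i \<noteq> 0} + S 1 i y * emeasure (M y) {v. v $ i \<noteq> 1}
      \<le> S 0 i y * emeasure (D y) {v. v $ i \<noteq> 0} + S 1 i y * emeasure (D y) {v. v $ i \<noteq> 1}" for y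
    proof -
      let ?m = "min (S 0 i y) (S 1 i y)"
      have Dy: "D y \<in> space (prob_algebra (count_space UNIV))"
        using D unfolding decoders_def by (rule measurable_space) simp
      then interpret Dy: prob_space "D y"
        by (simp add: space_prob_algebra)
      have s: "sets (D y) = UNIV" "space (D y) = UNIV"
        using Dy sets_eq_imp_space_eq[of "D y" "count_space UNIV"] by (simp_all add: space_prob_algebra)
      have "S 0 i y * emeasure (M y) {v. v $ i \<noteq> 0} + S 1 i y * emeasure (M y) {v. v $ i \<noteq> 1} = ?m"
        by (simp add: M_def f_def min_def)
      also have "?m = ?m * emeasure (D y) ({v. v $ i \<noteq> 0} \<union> {v. v $ i \<noteq> 1})"
      proof -
        have "{v. v $ i \<noteq> 0} \<union> {v. v $ i \<noteq> 1} = space (D y)"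
          by (auto simp: s simp del: bit_not_zero_iff bit_not_one_iff)
        then show ?thesis
          by (simp only: Dy.emeasure_space_1 mult_1_right)
      qed
      also have "\<dots> \<le> ?m * (emeasure (D y) {v. v $ i \<noteq> 0} + emeasure (D y) {v. v $ i \<noteq> 1})"
        by (intro mult_left_mono emeasure_subadditive) (auto simp: s)
      also have "\<dots> \<le> S 0 i y * emeasure (D y) {v. v $ i \<noteq> 0} + S 1 i y * emeasure (D y) {v. v $ i \<noteq> 1}"
        unfolding distrib_left by (intro add_mono mult_right_mono) auto
      finally show ?thesis .
    qed
    then have "ennreal (measure (transmission G \<sigma> M) {(u, v). v $ i \<noteq> u $ i})
      \<le> ennreal (measure (transmission G \<sigma> D) {(u, v). v $ i \<noteq> u $ i})"
      unfolding err[OF M] err[OF D] by (intro mult_left_mono nn_integral_mono) auto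
    then show ?thesis
      by simp
  qed
  have opt: "bit_error_prob G \<sigma> M \<le> bit_error_prob G \<sigma> D" if "D \<in> decoders" for D
    unfolding bit_error_prob_def by (intro divide_right_mono sum_mono le that) simp
  have "min_bit_error_prob G \<sigma> = bit_error_prob G \<sigma> M"
    unfolding min_bit_error_prob_def using M opt by (intro cInf_eq_minimum) auto
  then show ?thesis
    using M opt by auto
qed

section \<open>The quantities in the bound\<close>

definition Q :: "real \<Rightarrow> real" where
  "Q x = (LBINT z:{x..}. 1 / sqrt (2 * pi) * exp (- z\<^sup>2 / 2))"

text \<open>
  The integer arguments keep an upper limit of \<open>-1\<close> distinct from \<open>0\<close>; \<open>nat\<close> reads a negative
  number of trials as \<open>0\<close>, and the binomial coefficient vanishes when \<open>m\<close> exceeds that number.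
\<close>

definition B :: "real \<Rightarrow> int \<Rightarrow> int \<Rightarrow> int \<Rightarrow> real" where
  "B p Nt Nl Nu =
     (\<Sum>m\<in>{m :: nat. Nl \<le> int m \<and> int m \<le> Nu}.
        real (nat Nt choose m) * p ^ m * (1 - p) ^ (nat Nt - m))"

definition h' :: "bit ^ 'n ^ 'k \<Rightarrow> real \<Rightarrow> nat \<Rightarrow> nat \<Rightarrow> real" where
  "h' G \<sigma> ds d =
     (let n = int CARD('n);
          pb = Q (1 / \<sigma>);
          q = Q (sqrt (real d) / \<sigma>)
      in min
           (bit_weight_enum G d * q * B pb (n - int d) 0 (int ds - 1))
           (real (max_input_weight G d) / real CARD('k) *
             ((real (weight_enum G d) - 1) * (q - q\<^sup>2 / 2) * B pb (n - 2 * int d) 0 (int ds - 1) + q)))"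

end

theory Submission
  imports Defs
begin

text \<open>
  The optimal decoder is compared with a suboptimal one, which lists the codewords within Hamming
  distance \<open>d\<^sup>*\<close> of the hard decision and picks the one in the list closest to \<open>y\<close>. Multiplying the
  noise by the transmitted signal keeps it i.i.d. normal, so the analysis is the same for every
  codeword. If there are more than \<open>d\<^sup>*\<close> hard errors, the decoder is charged with an error, which
  gives the last term of the bound. Otherwise the decoded and the transmitted codeword differ in at
  most \<open>2d\<^sup>*\<close> places; if they differ exactly on \<open>S\<close>, the noise satisfies a half-space condition on
  \<open>S\<close>. This condition forces a hard error in \<open>S\<close>, leaving at most \<open>d\<^sup>* - 1\<close> errors outside \<open>S\<close>,
  and these are independent of what happens on \<open>S\<close>; this is the origin of the factors \<open>B\<close>.

  For the second bound in \<open>h'\<close>, one error event of weight \<open>d\<close> is counted fully, and the others only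
  outside it. Two such events \<open>S\<close>, \<open>S'\<close> are independent and equally likely given the noise on
  \<open>S \<inter> S'\<close>, hence by Jensen their intersection has probability at least \<open>Q\<^sup>2 \<ge> Q\<^sup>2 / 2\<close>.
\<close>

section \<open>Normal random variables\<close>

text \<open>The reflected and rescaled variable \<open>- X x / \<sigma>\<close> is standard normal,
  so the lower tail of \<open>X\<close> becomes the upper tail that \<open>Q\<close>
  integrates.\<close>

lemma (in prob_space) prob_normal_le:
  assumes "distributed M lborel X (normal_density 0 \<sigma>)" and "\<sigma> > 0"
  shows "\<P>(x in M. X x \<le> - a) = Q (a / \<sigma>)"
proof -
  have D: "distributed M lborel (\<lambda>x. 0 + (- 1 / \<sigma>) * X x) (normal_density (0 + (- 1 / \<sigma>) * 0) (\<bar>- 1 / \<sigma>\<bar> * \<sigma>))"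
    using assms by (intro normal_density_affine) auto
  then have D: "distributed M lborel (\<lambda>x. - X x / \<sigma>) std_normal_density"
    using assms(2) by simp
  have "\<P>(x in M. X x \<le> - a) = \<P>(x in M. - X x / \<sigma> \<in> {a / \<sigma>..})"
  proof -
    have "X x \<le> - a \<longleftrightarrow> a / \<sigma> \<le> - X x / \<sigma>" for x
      using assms(2) by (subst divide_le_cancel) auto
    then show ?thesis
      by simp
  qed
  also have "\<dots> = expectation (indicator {x\<in>space M. - X x / \<sigma> \<in> {a / \<sigma>..}})"
    by (subst Bochner_Integration.integral_indicator) (auto intro: arg_cong[where f = prob])
  also have "\<dots> = expectation (\<lambda>x. indicator {a / \<sigma>..} (- X x / \<sigma>))"
    by (intro Bochner_Integration.integral_cong) (auto simp: indicator_def)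
  also have "\<dots> = (\<integral>x. std_normal_density x * indicator {a / \<sigma>..} x \<partial>lborel)"
    by (rule distributed_integral[OF D, symmetric]) auto
  also have "\<dots> = Q (a / \<sigma>)"
    unfolding Q_def set_lebesgue_integral_def by (simp add: std_normal_density_def mult.commute)
  finally show ?thesis .
qed

text \<open>\<open>awgn\<close> is the image of a product measure under the bijection between
  functions and vectors, so the joint law of the coordinates is again that product; this
  characterizes independence.\<close>

lemma awgn_coordinates:
  assumes "\<sigma> > 0"
  shows "prob_space.indep_vars (awgn \<sigma>) (\<lambda>_. borel) (\<lambda>t z. z $ t) (UNIV :: 'n::finite set)"
    and "distributed (awgn \<sigma>) lborel (\<lambda>z. z $ (t :: 'n)) (normal_density 0 \<sigma>)"
proof -
  interpret prob_space "awgn \<sigma> :: (real ^ 'n) measure"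
    by (rule prob_space_awgn[OF assms])
  define N where "N = density lborel (normal_density 0 \<sigma>)"
  have N: "prob_space N"
    unfolding N_def using assms by (rule prob_space_normal_density)
  have sN[measurable_cong]: "sets N = sets borel"
    by (simp add: N_def)
  have sP: "sets (Pi\<^sub>M (UNIV :: 'n set) (\<lambda>_. N)) = sets (Pi\<^sub>M UNIV (\<lambda>_. borel))"
    by (intro sets_PiM_cong refl sN)
  have vec[measurable]: "(\<lambda>z. \<chi> t. z t) \<in> Pi\<^sub>M (UNIV :: 'n set) (\<lambda>_. N) \<rightarrow>\<^sub>M borel"
    by (subst borel_measurable_euclidean_space)
       (auto simp: Basis_vec_def inner_axis N_def intro!: borel_measurable_inner)
  have coord: "distr (awgn \<sigma>) borel (\<lambda>z. z $ s) = N" for s :: 'n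
  proof -
    have "distr (awgn \<sigma>) borel (\<lambda>z. z $ s) = distr (Pi\<^sub>M UNIV (\<lambda>_. N)) borel (\<lambda>z. z s)"
      unfolding awgn_def N_def[symmetric] by (subst distr_distr) (auto simp: comp_def)
    also have "\<dots> = distr (Pi\<^sub>M UNIV (\<lambda>_. N)) N (\<lambda>z. z s)"
      by (intro distr_cong) (auto simp: sN)
    also have "\<dots> = N"
      using N by (intro distr_PiM_component) auto
    finally show ?thesis .
  qed
  have "distr (awgn \<sigma>) (Pi\<^sub>M UNIV (\<lambda>_. borel)) (\<lambda>z. \<lambda>s\<in>(UNIV :: 'n set). z $ s)
      = distr (Pi\<^sub>M UNIV (\<lambda>_. N)) (Pi\<^sub>M UNIV (\<lambda>_. borel)) (\<lambda>z. z)"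
    unfolding awgn_def N_def[symmetric]
    by (subst distr_distr) (auto simp: comp_def restrict_UNIV vec_lambda_inverse intro!: measurable_PiM_single')
  also have "\<dots> = Pi\<^sub>M UNIV (\<lambda>_. N)"
    by (rule distr_id2) (simp add: sP)
  finally show "indep_vars (\<lambda>_. borel) (\<lambda>t z. z $ t) (UNIV :: 'n set)"
    by (subst indep_vars_iff_distr_eq_PiM') (auto simp: coord)
  show "distributed (awgn \<sigma>) lborel (\<lambda>z. z $ t) (normal_density 0 \<sigma>)"
    unfolding distributed_def
    using coord[of t] by (simp add: N_def cong: distr_cong)
qed

text \<open>Conditioning on \<open>X\<close> turns the two sides into a squared mean and a mean square.\<close>

lemma (in prob_space) prob_conditionally_iid_ge:
  fixes X W :: "'a \<Rightarrow> 'b" and f f' h :: "'b \<Rightarrow> real"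
  assumes ind: "indep_var N X N' W" "indep_var borel (\<lambda>w. f (W w)) borel (\<lambda>w. f' (W w))"
    and eq: "\<And>c. \<P>(w in M. f (W w) \<le> c) = \<P>(w in M. f' (W w) \<le> c)"
    and h[measurable]: "h \<in> borel_measurable N"
    and f[measurable]: "f \<in> borel_measurable N'" "f' \<in> borel_measurable N'"
  shows "(\<P>(w in M. f (W w) \<le> h (X w)))\<^sup>2 \<le> \<P>(w in M. f (W w) \<le> h (X w) \<and> f' (W w) \<le> h (X w))"
proof -
  define \<mu> \<nu> where "\<mu> = distr M N X" and "\<nu> = distr M N' W"
  have [measurable]: "random_variable N X" "random_variable N' W"
    using indep_var_rv1[OF ind(1)] indep_var_rv2[OF ind(1)] .
  interpret \<mu>: prob_space \<mu>
    unfolding \<mu>_def by (rule prob_space_distr) measurable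
  interpret \<nu>: prob_space \<nu>
    unfolding \<nu>_def by (rule prob_space_distr) measurable
  have [measurable_cong]: "sets \<mu> = sets N" "sets \<nu> = sets N'"
    by (simp_all add: \<mu>_def \<nu>_def)
  have J: "distr M (N \<Otimes>\<^sub>M N') (\<lambda>w. (X w, W w)) = \<mu> \<Otimes>\<^sub>M \<nu>"
    using ind(1) unfolding indep_var_distribution_eq \<mu>_def \<nu>_def by simp
  define F where "F c = \<P>(w in M. f (W w) \<le> c)" for c
  have F01: "0 \<le> F c" "F c \<le> 1" for c
    by (simp_all add: F_def)
  have "mono F"
    unfolding F_def by (intro monoI finite_measure_mono) auto
  then have [measurable]: "F \<in> borel_measurable borel"
    by (rule borel_measurable_mono)
  have int: "integrable \<mu> (\<lambda>x. F (h x))" "integrable \<mu> (\<lambda>x. (F (h x))\<^sup>2)"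
    using F01 by (auto intro!: \<mu>.integrable_const_bound[where B = 1] simp: power_le_one)
  \<comment> \<open>Fubini on the product law \<open>J\<close>: integrate over \<open>W\<close> with
    the threshold frozen at \<open>h x\<close>. The general \<open>P\<close> serves both the single
    inequality and the conjunction.\<close>
  have joint: "\<P>(w in M. P (W w) (h (X w))) = (\<integral>x. g (h x) \<partial>\<mu>)"
    if P: "{p\<in>space (N \<Otimes>\<^sub>M N'). P (snd p) (h (fst p))} \<in> sets (N \<Otimes>\<^sub>M N')"
      and g: "\<And>c. \<P>(w in M. P (W w) c) = g c" "integrable \<mu> (\<lambda>x. g (h x))"
    for P g
  proof -
    let ?A = "{p\<in>space (N \<Otimes>\<^sub>M N'). P (snd p) (h (fst p))}"
    have A: "?A \<in> sets (\<mu> \<Otimes>\<^sub>M \<nu>)"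
      using P by (simp only: J[symmetric] sets_distr)
    have sec: "emeasure \<nu> (Pair x -` ?A) = ennreal (g (h x))" if "x \<in> space \<mu>" for x
    proof -
      have "Pair x -` ?A \<in> sets N'"
        using sets_Pair1[OF P] by simp
      then have "emeasure \<nu> (Pair x -` ?A) = emeasure M (W -` (Pair x -` ?A) \<inter> space M)"
        unfolding \<nu>_def by (subst emeasure_distr) auto
      also have "W -` (Pair x -` ?A) \<inter> space M = {w\<in>space M. P (W w) (h x)}"
        using that measurable_space[of W M N'] by (auto simp: space_pair_measure \<mu>_def)
      finally show ?thesis
        by (simp add: emeasure_eq_measure g)
    qed
    have "ennreal (\<P>(w in M. P (W w) (h (X w)))) = emeasure M ((\<lambda>w. (X w, W w)) -` ?A \<inter> space M)"
      using measurable_space[of W M N'] measurable_space[of X M N]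
      by (auto simp: emeasure_eq_measure space_pair_measure intro!: arg_cong[where f = prob])
    also have "\<dots> = emeasure (\<mu> \<Otimes>\<^sub>M \<nu>) ?A"
      using P by (simp add: J[symmetric] emeasure_distr)
    also have "\<dots> = (\<integral>\<^sup>+x. emeasure \<nu> (Pair x -` ?A) \<partial>\<mu>)"
      by (rule \<nu>.emeasure_pair_measure_alt[OF A])
    also have "\<dots> = (\<integral>\<^sup>+x. ennreal (g (h x)) \<partial>\<mu>)"
      by (intro nn_integral_cong sec)
    also have "\<dots> = ennreal (\<integral>x. g (h x) \<partial>\<mu>)"
      using g by (intro nn_integral_eq_integral) (auto simp: g(1)[symmetric])
    finally show ?thesis
      by (simp add: Bochner_Integration.integral_nonneg g(1)[symmetric])
  qed
  have 1: "\<P>(w in M. f (W w) \<le> h (X w)) = (\<integral>x. F (h x) \<partial>\<mu>)"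
    using int by (intro joint[of "\<lambda>v c. f v \<le> c"]) (auto simp: F_def)
  have "\<P>(w in M. f (W w) \<le> c \<and> f' (W w) \<le> c) = (F c)\<^sup>2" for c
  proof -
    have "\<P>(w in M. f (W w) \<in> {..c} \<and> f' (W w) \<in> {..c}) = \<P>(w in M. f (W w) \<in> {..c}) * \<P>(w in M. f' (W w) \<in> {..c})"
      by (rule prob_indep_random_variable[OF ind(2)]) auto
    then show ?thesis
      by (simp add: F_def eq power2_eq_square)
  qed
  then have 2: "\<P>(w in M. f (W w) \<le> h (X w) \<and> f' (W w) \<le> h (X w)) = (\<integral>x. (F (h x))\<^sup>2 \<partial>\<mu>)"
    using int by (intro joint[of "\<lambda>v c. f v \<le> c \<and> f' v \<le> c" "\<lambda>c. (F c)\<^sup>2"]) auto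
  \<comment> \<open>Jensen's inequality for the square, in the form that the variance of
    \<open>F (h x)\<close> is nonnegative.\<close>
  have "(\<integral>x. F (h x) \<partial>\<mu>)\<^sup>2 \<le> (\<integral>x. (F (h x))\<^sup>2 \<partial>\<mu>)"
    using \<mu>.variance_positive[of "\<lambda>x. F (h x)"] by (simp only: \<mu>.variance_eq[OF int])
  then show ?thesis
    using 1 2 by simp
qed

section \<open>Pairwise error events\<close>

locale iid_normal = prob_space M for M +
  fixes Z :: "'n::finite \<Rightarrow> 'a \<Rightarrow> real" and \<sigma> :: real
  assumes indep: "indep_vars (\<lambda>_. borel) Z UNIV"
    and normal: "\<And>t. distributed M lborel (Z t) (normal_density 0 \<sigma>)"
    and pos: "\<sigma> > 0"
begin

text \<open>\<open>Z t\<close> is the noise times the transmitted signal. Hence \<open>1 + Z t \<le> 0\<close> is a hard error at \<open>t\<close>, and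
  \<open>pairwise_error S\<close> says that the signal differing from the transmitted one on \<open>S\<close> is at least as close.\<close>

definition errors :: "'n set \<Rightarrow> 'a \<Rightarrow> nat" where
  "errors T w = card {t\<in>T. 1 + Z t w \<le> 0}"

definition pairwise_error :: "'n set \<Rightarrow> 'a set" where
  "pairwise_error S = {w\<in>space M. (\<Sum>t\<in>S. 1 + Z t w) \<le> 0}"

lemma measurable_Z [measurable]: "Z t \<in> borel_measurable M"
  using distributed_measurable[OF normal] by simp

lemma errors_measurable [measurable]: "errors T \<in> measurable M (count_space UNIV)"
proof -
  have "errors T = (\<lambda>w. \<Sum>t\<in>T. if 1 + Z t w \<le> 0 then 1 else 0)"
    by (auto simp: errors_def sum.If_cases Int_def)
  then show ?thesis
    by simp
qed

lemma pairwise_error_sets [measurable]: "pairwise_error S \<in> events"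
  unfolding pairwise_error_def by measurable

lemma sum_normal:
  assumes "S \<noteq> {}"
  shows "distributed M lborel (\<lambda>w. \<Sum>t\<in>S. Z t w) (normal_density 0 (sqrt (card S) * \<sigma>))"
  using sum_indep_normal[of S Z "\<lambda>_. \<sigma>" "\<lambda>_. 0"] assms indep_vars_subset[OF indep, of S] normal pos
  by (simp add: real_sqrt_mult)

text \<open>The noise sum over \<open>S\<close> has standard deviation
  \<open>sqrt (card S) * \<sigma>\<close> and must fall below \<open>- card S\<close>; the quotient
  simplifies to \<open>sqrt (card S) / \<sigma>\<close>.\<close>

lemma prob_pairwise_error:
  assumes "S \<noteq> {}"
  shows "prob (pairwise_error S) = Q (sqrt (card S) / \<sigma>)"
proof -
  have c: "card S > 0"
    using assms by (simp add: card_gt_0_iff)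
  have "prob (pairwise_error S) = \<P>(w in M. (\<Sum>t\<in>S. Z t w) \<le> - real (card S))"
    unfolding pairwise_error_def by (intro arg_cong[where f = prob] Collect_cong) (auto simp: sum.distrib)
  also have "\<dots> = Q (real (card S) / (sqrt (card S) * \<sigma>))"
    using c pos by (intro prob_normal_le sum_normal assms) auto
  also have "real (card S) / (sqrt (card S) * \<sigma>) = sqrt (card S) / \<sigma>"
    using c by (simp add: divide_divide_eq_left[symmetric] real_div_sqrt)
  finally show ?thesis .
qed

section \<open>The binomial law of the number of hard errors\<close>

lemma prob_errors_eq:
  "\<P>(w in M. errors T w = m) =
    real (card T choose m) * Q (1 / \<sigma>) ^ m * (1 - Q (1 / \<sigma>)) ^ (card T - m)"
proof -
  let ?p = "Q (1 / \<sigma>)"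
  \<comment> \<open>\<open>F A\<close> is the event that the hard errors within \<open>T\<close>
    occur exactly at \<open>A\<close>. Independence makes its probability a product, and the events
    for different \<open>A\<close> are disjoint.\<close>
  define C where "C A t = (if t \<in> A then {.. - 1 :: real} else {- 1 <..})" for A :: "'n set" and t
  define F where "F A = {w\<in>space M. \<forall>t\<in>T. Z t w \<in> C A t}" for A
  have neg: "\<P>(w in M. Z t w \<le> - 1) = ?p" for t
    using prob_normal_le[OF normal pos, of t 1] by simp
  have C: "prob (Z t -` C A t \<inter> space M) = (if t \<in> A then ?p else 1 - ?p)" for A t
  proof -
    have "Z t -` C A t \<inter> space M = (if t \<in> A then {w\<in>space M. Z t w \<le> - 1} else {w\<in>space M. \<not> Z t w \<le> - 1})"
      by (auto simp: C_def)
    then show ?thesis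
      using neg[of t] prob_neg[of "\<lambda>w. Z t w \<le> - 1"] by simp
  qed
  have F: "prob (F A) = ?p ^ card A * (1 - ?p) ^ (card T - card A)" if "A \<subseteq> T" for A
  \<comment> \<open>The empty case is separate because an intersection over no indices is
    \<open>UNIV\<close> rather than \<open>space M\<close>.\<close>
  proof (cases "T = {}")
    case True
    with that show ?thesis
      by (simp add: F_def prob_space)
  next
    case False
    then have "F A = (\<Inter>t\<in>T. Z t -` C A t \<inter> space M)"
      by (auto simp: F_def)
    also have "prob \<dots> = (\<Prod>t\<in>T. prob (Z t -` C A t \<inter> space M))"
      using False by (intro indep_varsD_finite[OF indep_vars_subset[OF indep]]) (auto simp: C_def)
    also have "\<dots> = ?p ^ card A * (1 - ?p) ^ (card T - card A)"
      using that by (simp add: C prod.If_cases card_Diff_subset Int_absorb1 Diff_eq[symmetric])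
    finally show ?thesis .
  qed
  have "{w\<in>space M. errors T w = m} = (\<Union>A\<in>{A. A \<subseteq> T \<and> card A = m}. F A)"
  proof (intro set_eqI iffI)
    fix w assume "w \<in> {w\<in>space M. errors T w = m}"
    then show "w \<in> (\<Union>A\<in>{A. A \<subseteq> T \<and> card A = m}. F A)"
      by (intro UN_I[of "{t\<in>T. 1 + Z t w \<le> 0}"]) (auto simp: errors_def F_def C_def)
  next
    fix w assume "w \<in> (\<Union>A\<in>{A. A \<subseteq> T \<and> card A = m}. F A)"
    then obtain A where A: "A \<subseteq> T" "card A = m" "w \<in> F A"
      by auto
    then have "{t\<in>T. 1 + Z t w \<le> 0} = A"
      by (fastforce simp: F_def C_def split: if_splits)
    with A show "w \<in> {w\<in>space M. errors T w = m}"
      by (simp add: errors_def F_def)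
  qed
  also have "prob \<dots> = (\<Sum>A\<in>{A. A \<subseteq> T \<and> card A = m}. prob (F A))"
  proof (rule finite_measure_finite_Union)
    show "F ` {A. A \<subseteq> T \<and> card A = m} \<subseteq> events"
      by (auto simp: F_def C_def)
    show "disjoint_family_on F {A. A \<subseteq> T \<and> card A = m}"
    proof (clarsimp simp: disjoint_family_on_def)
      fix A A' assume "A \<subseteq> T" "A' \<subseteq> T" "A \<noteq> A'"
      then obtain t where "t \<in> T" "t \<in> A \<longleftrightarrow> t \<notin> A'"
        by blast
      then show "F A \<inter> F A' = {}"
        by (force simp: F_def C_def split: if_splits)
    qed
  qed simp
  also have "\<dots> = (\<Sum>A\<in>{A. A \<subseteq> T \<and> card A = m}. ?p ^ m * (1 - ?p) ^ (card T - m))"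
    using F by (intro sum.cong) auto
  finally show ?thesis
    by (simp add: n_subsets)
qed

text \<open>Lets the formal sum \<open>B\<close> be handled as a probability, for instance to see
  that it is nonnegative.\<close>

lemma prob_errors_between:
  "B (Q (1 / \<sigma>)) (int (card T)) l u = \<P>(w in M. l \<le> int (errors T w) \<and> int (errors T w) \<le> u)"
proof -
  define K where "K = {m. l \<le> int m \<and> int m \<le> u}"
  have "finite K"
    unfolding K_def by (rule finite_subset[of _ "{..nat u}"]) auto
  then have "prob (\<Union>m\<in>K. {w\<in>space M. errors T w = m}) = (\<Sum>m\<in>K. prob {w\<in>space M. errors T w = m})"
    by (intro finite_measure_finite_Union) (auto simp: disjoint_family_on_def)
  moreover have "(\<Union>m\<in>K. {w\<in>space M. errors T w = m}) = {w\<in>space M. l \<le> int (errors T w) \<and> int (errors T w) \<le> u}"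
    by (auto simp: K_def)
  ultimately show ?thesis
    by (simp add: B_def prob_errors_eq K_def)
qed

text \<open>Noise restricted to disjoint position sets is independent. The predicate
  \<open>P\<close> is left general so that it covers a single error event as well as the difference
  of two.\<close>

lemma prob_Int_errors:
  assumes "S \<inter> T = {}" and P: "{x\<in>space (Pi\<^sub>M S (\<lambda>_. borel)). P x} \<in> sets (Pi\<^sub>M S (\<lambda>_. borel))"
  shows "\<P>(w in M. P (restrict (\<lambda>t. Z t w) S) \<and> errors T w < m)
    = \<P>(w in M. P (restrict (\<lambda>t. Z t w) S)) * B (Q (1 / \<sigma>)) (int (card T)) 0 (int m - 1)"
proof -
  let ?X = "\<lambda>S w. restrict (\<lambda>t. Z t w) S"
  let ?A = "{x\<in>space (Pi\<^sub>M S (\<lambda>_. borel)). P x}"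
  let ?B = "{x\<in>space (Pi\<^sub>M T (\<lambda>_. borel)). (\<Sum>t\<in>T. if 1 + x t \<le> (0 :: real) then 1 else 0) < m}"
  have e: "errors T w = (\<Sum>t\<in>T. if 1 + ?X T w t \<le> 0 then 1 else 0)" for w
    by (auto simp: errors_def sum.If_cases Int_def intro!: arg_cong[where f = card])
  have ind: "indep_var (Pi\<^sub>M S (\<lambda>_. borel)) (?X S) (Pi\<^sub>M T (\<lambda>_. borel)) (?X T)"
    using assms(1) by (intro indep_var_restrict[OF indep]) auto
  have "?B \<in> sets (Pi\<^sub>M T (\<lambda>_. borel))"
    by measurable
  then have "prob ((\<lambda>w. (?X S w, ?X T w)) -` (?A \<times> ?B) \<inter> space M)
      = prob (?X S -` ?A \<inter> space M) * prob (?X T -` ?B \<inter> space M)"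
    using P by (intro indep_varD[OF ind])
  moreover have "(\<lambda>w. (?X S w, ?X T w)) -` (?A \<times> ?B) \<inter> space M = {w\<in>space M. P (?X S w) \<and> errors T w < m}"
    unfolding e by (auto simp: space_PiM)
  moreover have "?X S -` ?A \<inter> space M = {w\<in>space M. P (?X S w)}"
    by (auto simp: space_PiM)
  moreover have "?X T -` ?B \<inter> space M = {w\<in>space M. errors T w < m}"
    unfolding e by (auto simp: space_PiM)
  \<comment> \<open>For \<open>m = 0\<close> the upper limit is \<open>-1\<close>, so both sides are
    false.\<close>
  moreover have "0 \<le> int (errors T w) \<and> int (errors T w) \<le> int m - 1 \<longleftrightarrow> errors T w < m" for w
    by auto
  ultimately show ?thesis
    by (simp only: prob_errors_between)
qed

text \<open>A sum over a nonempty set that is not positive has a term that is not positive. This is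
  a hard error in \<open>S\<close>, which \<open>errors T\<close> does not count.\<close>

lemma errors_outside_less:
  assumes "w \<in> pairwise_error S" "S \<noteq> {}" "S \<inter> T = {}"
  shows "errors T w < errors UNIV w"
proof -
  have "\<exists>t\<in>S. 1 + Z t w \<le> 0"
  proof (rule ccontr)
    assume "\<not> ?thesis"
    then have "(\<Sum>t\<in>S. 1 + Z t w) > 0"
      using assms(2) by (intro sum_pos) (auto simp: not_le)
    then show False
      using assms(1) by (simp add: pairwise_error_def)
  qed
  then show ?thesis
    using assms(3) unfolding errors_def by (intro psubset_card_mono) auto
qed

section \<open>Error events together with few hard errors\<close>

lemma pairwise_error_restrict:
  "S \<subseteq> S' \<Longrightarrow> w \<in> space M \<Longrightarrow>
    w \<in> pairwise_error S \<longleftrightarrow> (\<Sum>t\<in>S. 1 + restrict (\<lambda>t. Z t w) S' t) \<le> 0"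
  by (auto simp: pairwise_error_def intro!: arg_cong[where f = "\<lambda>x. x \<le> 0"] sum.cong)

text \<open>Gives the first argument of the minimum in \<open>h'\<close>: fewer than
  \<open>m\<close> hard errors remain on \<open>- S\<close>, and their number is independent of the
  noise on \<open>S\<close>.\<close>

lemma prob_pairwise_error_few_errors:
  assumes "S \<noteq> {}"
  shows "prob (pairwise_error S \<inter> {w\<in>space M. errors UNIV w \<le> m})
    \<le> Q (sqrt (card S) / \<sigma>) * B (Q (1 / \<sigma>)) (int CARD('n) - int (card S)) 0 (int m - 1)"
proof -
  let ?P = "\<lambda>x. (\<Sum>t\<in>S. 1 + x t) \<le> (0 :: real)"
  have E: "pairwise_error S = {w\<in>space M. ?P (restrict (\<lambda>t. Z t w) S)}"
    using pairwise_error_restrict[of S S] by (auto simp: pairwise_error_def)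
  have "prob (pairwise_error S \<inter> {w\<in>space M. errors UNIV w \<le> m})
      \<le> \<P>(w in M. ?P (restrict (\<lambda>t. Z t w) S) \<and> errors (- S) w < m)"
    using errors_outside_less[of _ S "- S"] assms pairwise_error_restrict[of S S]
    by (intro finite_measure_mono) (fastforce simp: E)+
  also have "\<dots> = prob (pairwise_error S) * B (Q (1 / \<sigma>)) (int (card (- S))) 0 (int m - 1)"
    unfolding E by (intro prob_Int_errors) auto
  also have "int (card (- S)) = int CARD('n) - int (card S)"
    using card_mono[of "UNIV :: 'n set" S] by (simp add: Compl_eq_Diff_UNIV card_Diff_subset of_nat_diff)
  finally show ?thesis
    by (simp add: prob_pairwise_error[OF assms])
qed

text \<open>Given the noise on the common positions, both events put a sum over private positions
  below the same threshold; these two sums are independent and identically distributed.\<close>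

lemma prob_two_pairwise_errors_ge:
  assumes "S \<noteq> S'" "card S = card S'"
  shows "(prob (pairwise_error S))\<^sup>2 \<le> prob (pairwise_error S \<inter> pairwise_error S')"
proof -
  let ?X = "\<lambda>S w. restrict (\<lambda>t. Z t w) S"
  let ?D = "(S - S') \<union> (S' - S)"
  let ?s = "\<lambda>S x. \<Sum>t\<in>S. x t :: real"
  \<comment> \<open>Equal cardinalities make the private parts equally large, so their sums have the
    same law; since \<open>S \<noteq> S'\<close>, neither part is empty.\<close>
  have card: "card (S - S') = card (S' - S)"
    using assms(2) by (simp add: card_Diff_subset_Int Int_commute)
  moreover have "S - S' \<noteq> {} \<or> S' - S \<noteq> {}"
    using assms(1) by auto
  ultimately have ne: "S - S' \<noteq> {}" "S' - S \<noteq> {}"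
    by (metis card_eq_0_iff finite)+
  have sum: "?s T (?X T' w) = (\<Sum>t\<in>T. Z t w)" if "T \<subseteq> T'" for T T' w
    using that by (auto intro!: sum.cong)
  have split: "(\<Sum>t\<in>T. 1 + Z t w) \<le> 0 \<longleftrightarrow>
      ?s (T - T') (?X ?D w) \<le> - real (card T) - ?s (S \<inter> S') (?X (S \<inter> S') w)"
    if "T = S \<and> T' = S' \<or> T = S' \<and> T' = S" for T T' w
  proof -
    have "(\<Sum>t\<in>T. Z t w) = (\<Sum>t\<in>T - T'. Z t w) + (\<Sum>t\<in>S \<inter> S'. Z t w)"
      using that sum.Int_Diff[of T "\<lambda>t. Z t w" T'] by (auto simp: Int_commute)
    moreover have "?s (T - T') (?X ?D w) = (\<Sum>t\<in>T - T'. Z t w)"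
      using that by (intro sum) auto
    moreover have "?s (S \<inter> S') (?X (S \<inter> S') w) = (\<Sum>t\<in>S \<inter> S'. Z t w)"
      by (intro sum) auto
    ultimately show ?thesis
      by (auto simp: sum.distrib)
  qed
  have E: "pairwise_error S = {w\<in>space M. ?s (S - S') (?X ?D w)
      \<le> - real (card S) - ?s (S \<inter> S') (?X (S \<inter> S') w)}"
    unfolding pairwise_error_def using split[of S S'] by simp
  have E': "pairwise_error S' = {w\<in>space M. ?s (S' - S) (?X ?D w)
      \<le> - real (card S) - ?s (S \<inter> S') (?X (S \<inter> S') w)}"
    unfolding pairwise_error_def using split[of S' S] assms(2) by simp
  have "(\<P>(w in M. ?s (S - S') (?X ?D w) \<le> - real (card S) - ?s (S \<inter> S') (?X (S \<inter> S') w)))\<^sup>2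
      \<le> \<P>(w in M. ?s (S - S') (?X ?D w) \<le> - real (card S) - ?s (S \<inter> S') (?X (S \<inter> S') w)
          \<and> ?s (S' - S) (?X ?D w) \<le> - real (card S) - ?s (S \<inter> S') (?X (S \<inter> S') w))"
  proof (rule prob_conditionally_iid_ge[where X = "?X (S \<inter> S')" and W = "?X ?D"
        and f = "?s (S - S')" and f' = "?s (S' - S)"
        and h = "\<lambda>x. - real (card S) - ?s (S \<inter> S') x"
        and N = "Pi\<^sub>M (S \<inter> S') (\<lambda>_. borel)" and N' = "Pi\<^sub>M ?D (\<lambda>_. borel)"])
    show "indep_var (Pi\<^sub>M (S \<inter> S') (\<lambda>_. borel)) (?X (S \<inter> S')) (Pi\<^sub>M ?D (\<lambda>_. borel)) (?X ?D)"
      by (intro indep_var_restrict[OF indep]) auto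
    have "indep_var borel (?s (S - S') \<circ> ?X (S - S')) borel (?s (S' - S) \<circ> ?X (S' - S))"
      by (intro indep_var_compose[OF indep_var_restrict[OF indep]]) auto
    moreover have "?s (S - S') \<circ> ?X (S - S') = (\<lambda>w. ?s (S - S') (?X ?D w))"
        "?s (S' - S) \<circ> ?X (S' - S) = (\<lambda>w. ?s (S' - S) (?X ?D w))"
      by (auto simp: fun_eq_iff intro!: sum.cong)
    ultimately show "indep_var borel (\<lambda>w. ?s (S - S') (?X ?D w)) borel (\<lambda>w. ?s (S' - S) (?X ?D w))"
      by simp
    show "\<P>(w in M. ?s (S - S') (?X ?D w) \<le> c) = \<P>(w in M. ?s (S' - S) (?X ?D w) \<le> c)" for c
    proof -
      have pos': "sqrt (card T) * \<sigma> > 0" if "T \<noteq> {}" for T :: "'n set"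
        using that pos by (simp add: card_gt_0_iff)
      show ?thesis
        using prob_normal_le[OF sum_normal[OF ne(1)] pos'[OF ne(1)], of "- c"]
          prob_normal_le[OF sum_normal[OF ne(2)] pos'[OF ne(2)], of "- c"]
        by (simp add: sum card)
    qed
  qed measurable
  also have "\<dots> = prob (pairwise_error S \<inter> pairwise_error S')"
    unfolding E E' by (intro arg_cong[where f = prob]) auto
  finally show ?thesis
    by (simp only: E)
qed

text \<open>Gives the second argument of the minimum in \<open>h'\<close>. One index
  \<open>j\<close> is charged its full probability; every other index is charged only for the part
  of its event outside that of \<open>j\<close>.\<close>

lemma prob_union_pairwise_errors:
  assumes "finite I" "I \<noteq> {}" "inj_on S I" "\<And>i. i \<in> I \<Longrightarrow> card (S i) = d" "d > 0"
  shows "prob (\<Union>i\<in>I. pairwise_error (S i) \<inter> {w\<in>space M. errors UNIV w \<le> m})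
    \<le> (real (card I) - 1) * (Q (sqrt d / \<sigma>) - (Q (sqrt d / \<sigma>))\<^sup>2 / 2)
         * B (Q (1 / \<sigma>)) (int CARD('n) - 2 * int d) 0 (int m - 1) + Q (sqrt d / \<sigma>)"
proof -
  let ?q = "Q (sqrt d / \<sigma>)" and ?b = "B (Q (1 / \<sigma>)) (int CARD('n) - 2 * int d) 0 (int m - 1)"
  let ?F = "{w\<in>space M. errors UNIV w \<le> m}"
  obtain j where j: "j \<in> I"
    using assms(2) by auto
  have ne: "S i \<noteq> {}" if "i \<in> I" for i
    using assms(4)[OF that] assms(5) by auto
  have q: "prob (pairwise_error (S i)) = ?q" if "i \<in> I" for i
    using prob_pairwise_error[OF ne[OF that]] assms(4)[OF that] by simp
  have extra: "prob ((pairwise_error (S i) - pairwise_error (S j)) \<inter> ?F) \<le> (?q - ?q\<^sup>2 / 2) * ?b"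
    if i: "i \<in> I - {j}" for i
  proof -
    let ?U = "S i \<union> S j" and ?X = "\<lambda>S w. restrict (\<lambda>t. Z t w) S"
    let ?P = "\<lambda>x. (\<Sum>t\<in>S i. 1 + x t) \<le> (0 :: real) \<and> \<not> (\<Sum>t\<in>S j. 1 + x t) \<le> (0 :: real)"
    \<comment> \<open>Two sets of size \<open>d\<close> cover at most \<open>2 * d\<close>
      positions. Choosing exactly this many positions \<open>T\<close> outside them produces the
      trial number in \<open>B\<close>, even when the sets overlap.\<close>
    have "nat (int CARD('n) - 2 * int d) \<le> card (- ?U)"
    proof -
      have "card ?U \<le> 2 * d"
        using card_Un_le[of "S i" "S j"] assms(4) i j by auto
      moreover have "card (- ?U) = CARD('n) - card ?U"
        by (simp add: Compl_eq_Diff_UNIV card_Diff_subset)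
      ultimately show ?thesis
        by linarith
    qed
    then obtain T where T: "T \<subseteq> - ?U" "card T = nat (int CARD('n) - 2 * int d)"
      by (meson obtain_subset_with_card_n)
    have E: "pairwise_error (S i) - pairwise_error (S j) = {w\<in>space M. ?P (?X ?U w)}"
      using pairwise_error_restrict[of "S i" ?U] pairwise_error_restrict[of "S j" ?U]
      by (auto simp: pairwise_error_def)
    have "(pairwise_error (S i) - pairwise_error (S j)) \<inter> ?F
        \<subseteq> (pairwise_error (S i) - pairwise_error (S j)) \<inter> {w\<in>space M. errors T w < m}"
    proof
      fix w assume w: "w \<in> (pairwise_error (S i) - pairwise_error (S j)) \<inter> ?F"
      then have "errors T w < errors UNIV w"
        using T i ne by (intro errors_outside_less[of w "S i"]) auto
      then show "w \<in> (pairwise_error (S i) - pairwise_error (S j)) \<inter> {w\<in>space M. errors T w < m}"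
        using w by auto
    qed
    then have "prob ((pairwise_error (S i) - pairwise_error (S j)) \<inter> ?F)
        \<le> prob ((pairwise_error (S i) - pairwise_error (S j)) \<inter> {w\<in>space M. errors T w < m})"
      by (intro finite_measure_mono) auto
    also have "\<dots> = \<P>(w in M. ?P (?X ?U w) \<and> errors T w < m)"
      unfolding E by (intro arg_cong[where f = prob]) auto
    also have "\<dots> = prob (pairwise_error (S i) - pairwise_error (S j)) * B (Q (1 / \<sigma>)) (int (card T)) 0 (int m - 1)"
      unfolding E using T(1) by (intro prob_Int_errors) auto
    \<comment> \<open>\<open>B\<close> applies \<open>nat\<close> to its trial number, so a negative
      \<open>n - 2 * d\<close> agrees with \<open>card T = 0\<close>.\<close>
    also have b: "B (Q (1 / \<sigma>)) (int (card T)) 0 (int m - 1) = ?b"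
      by (simp add: T(2) B_def)
    also have "prob (pairwise_error (S i) - pairwise_error (S j))
        = ?q - prob (pairwise_error (S i) \<inter> pairwise_error (S j))"
      using i by (simp add: finite_measure_Diff' q)
    also have "\<dots> * ?b \<le> (?q - ?q\<^sup>2 / 2) * ?b"
    proof (rule mult_right_mono)
      have "S i \<noteq> S j"
        using assms(3) i j by (auto dest: inj_onD)
      then have "?q\<^sup>2 \<le> prob (pairwise_error (S i) \<inter> pairwise_error (S j))"
        using prob_two_pairwise_errors_ge[of "S i" "S j"] q assms(4) i j by simp
      then show "?q - prob (pairwise_error (S i) \<inter> pairwise_error (S j)) \<le> ?q - ?q\<^sup>2 / 2"
        using zero_le_power2[of ?q] by linarith
      show "0 \<le> ?b"
        by (simp only: b[symmetric] prob_errors_between measure_nonneg)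
    qed
    finally show ?thesis .
  qed
  \<comment> \<open>The restriction to few hard errors is dropped for \<open>j\<close> alone, which
    explains the last summand without a factor \<open>B\<close>.\<close>
  have "prob (\<Union>i\<in>I. pairwise_error (S i) \<inter> ?F)
      \<le> prob (pairwise_error (S j) \<union> (\<Union>i\<in>I - {j}. (pairwise_error (S i) - pairwise_error (S j)) \<inter> ?F))"
    by (intro finite_measure_mono sets.Un sets.finite_UN) (use assms(1) in auto)
  also have "\<dots> \<le> prob (pairwise_error (S j)) + prob (\<Union>i\<in>I - {j}. (pairwise_error (S i) - pairwise_error (S j)) \<inter> ?F)"
    using assms(1) by (intro measure_Un_le sets.finite_UN) auto
  also have "prob (\<Union>i\<in>I - {j}. (pairwise_error (S i) - pairwise_error (S j)) \<inter> ?F)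
      \<le> (\<Sum>i\<in>I - {j}. prob ((pairwise_error (S i) - pairwise_error (S j)) \<inter> ?F))"
    using assms(1) by (intro measure_UNION_le) auto
  also have "\<dots> \<le> (\<Sum>i\<in>I - {j}. (?q - ?q\<^sup>2 / 2) * ?b)"
    by (intro sum_mono extra)
  also have "\<dots> = (real (card I) - 1) * (?q - ?q\<^sup>2 / 2) * ?b"
    using j assms(1) card_gt_0_iff[of I] by (auto simp: card_Diff_singleton of_nat_diff Suc_le_eq)
  finally show ?thesis
    using q[OF j] by simp
qed

end

section \<open>Encoding and weight enumerators\<close>

lemma linear_encode:
  fixes G :: "bit ^ 'n ^ 'k"
  shows "Vector_Spaces.linear (*s) (*s) (\<lambda>u. u v* G)"
  unfolding transpose_matrix_vector[symmetric] by (rule matrix_vector_mul_linear_gen)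

text \<open>A linear right inverse \<open>g\<close> is injective on the code, so its image has full
  dimension and is the whole space. Every vector is then some \<open>g v\<close> with
  \<open>v\<close> in the code, which makes \<open>g\<close> a left inverse too.\<close>

lemma inj_encode:
  fixes G :: "bit ^ 'n ^ 'k"
  assumes "vec.dim (code G) = CARD('k)"
  shows "inj (\<lambda>u. u v* G)"
proof -
  let ?f = "\<lambda>u. u v* G"
  obtain g where g: "Vector_Spaces.linear (*s) (*s) g" "\<And>v. v \<in> range ?f \<Longrightarrow> ?f (g v) = v"
    using vec.linear_exists_right_inverse_on[OF linear_encode[of G] vec.subspace_UNIV] by auto
  have sub: "vec.subspace (code G)"
    unfolding code_def by (rule vec.linear_subspace_image[OF linear_encode vec.subspace_UNIV])
  have "inj_on g (code G)"
    unfolding code_def by (rule inj_on_inverseI[where g = ?f, OF g(2)])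
  then have "vec.dim (g ` code G) = CARD('k)"
    using vec.dim_image_eq[OF g(1), of "code G"] assms by (simp add: vec.span_eq_iff[THEN iffD2, OF sub])
  moreover have "vec.subspace (g ` code G)"
    by (rule vec.linear_subspace_image[OF g(1) sub])
  ultimately have "g ` code G = UNIV"
    by (intro vec.subspace_dim_equal) (auto simp: card_cart_basis)
  then have "x = g (?f x)" for x
  proof -
    obtain v where "v \<in> code G" "x = g v"
      using \<open>g ` code G = UNIV\<close> by (metis UNIV_I imageE)
    then show ?thesis
      using g(2)[of v] by (simp add: code_def)
  qed
  then show ?thesis
    by (metis injI)
qed

section \<open>Supports, and weight enumerators as counts of information vectors\<close>

definition support :: "bit ^ 'n \<Rightarrow> 'n set" where
  "support c = {t. c $ t \<noteq> 0}"

lemma card_support: "card (support c) = hamming_weight c"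
  by (simp add: support_def hamming_weight_def)

lemma support_inj: "support c = support c' \<Longrightarrow> c = c'"
  by (auto simp: support_def vec_eq_iff set_eq_iff) (metis bit_not_zero_iff)

lemma hamming_weight_le: "hamming_weight (c :: bit ^ 'n) \<le> CARD('n)"
  unfolding hamming_weight_def by (rule card_mono) auto

lemma hamming_weight_pos: "c \<noteq> 0 \<Longrightarrow> 0 < hamming_weight (c :: bit ^ 'n)"
  by (auto simp: hamming_weight_def card_gt_0_iff vec_eq_iff)

text \<open>Converts error contributions added up over bit positions into the weight factor of the
  bit-weight enumerator.\<close>

lemma sum_hamming_weight:
  "(\<Sum>i\<in>UNIV. if v $ i \<noteq> 0 then x else 0) = real (hamming_weight v) * x"
  by (simp add: hamming_weight_def sum.If_cases)

text \<open>Under injective encoding, codewords can be counted through their information vectors,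
  which carry both the input and the output weight.\<close>

definition inputs :: "bit ^ 'n ^ 'k \<Rightarrow> nat \<Rightarrow> (bit ^ 'k) set" where
  "inputs G d = {v. hamming_weight (v v* G) = d}"

lemma io_weight_eq:
  assumes "inj (\<lambda>u. u v* G)"
  shows "io_weight G i d = card {v\<in>inputs G d. hamming_weight v = i}"
proof -
  have "{c. \<exists>u. c = u v* G \<and> hamming_weight u = i \<and> hamming_weight c = d}
      = (\<lambda>u. u v* G) ` {v\<in>inputs G d. hamming_weight v = i}"
    by (auto simp: inputs_def)
  then show ?thesis
    unfolding io_weight_def using assms by (simp add: card_image inj_on_subset)
qed

text \<open>Groups the information vectors by input weight. A constant \<open>f\<close> yields
  \<open>weight_enum\<close>, and \<open>f i = i / k\<close> yields
  \<open>bit_weight_enum\<close>.\<close>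

lemma sum_io_weight:
  fixes G :: "bit ^ 'n ^ 'k" and f :: "nat \<Rightarrow> real"
  assumes "inj (\<lambda>u. u v* G)"
  shows "(\<Sum>i\<le>CARD('k). f i * real (io_weight G i d)) = (\<Sum>v\<in>inputs G d. f (hamming_weight v))"
proof -
  have "(\<Sum>v\<in>inputs G d. f (hamming_weight v))
      = (\<Sum>i\<le>CARD('k). \<Sum>v\<in>{v\<in>inputs G d. hamming_weight v = i}. f (hamming_weight v))"
    by (rule sum.group[symmetric]) (auto simp: hamming_weight_le)
  also have "\<dots> = (\<Sum>i\<le>CARD('k). f i * real (io_weight G i d))"
    by (intro sum.cong) (auto simp: io_weight_eq[OF assms])
  finally show ?thesis ..
qed

lemma weight_enum_eq:
  assumes "inj (\<lambda>u. u v* G)"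
  shows "weight_enum G d = card (inputs G d)"
proof -
  have "real (weight_enum G d) = real (card (inputs G d))"
    using sum_io_weight[OF assms, of "\<lambda>_. 1" d] by (simp add: weight_enum_def)
  then show ?thesis
    by simp
qed

lemma bit_weight_enum_eq:
  fixes G :: "bit ^ 'n ^ 'k"
  assumes "inj (\<lambda>u. u v* G)"
  shows "bit_weight_enum G d = (\<Sum>v\<in>inputs G d. real (hamming_weight v) / real CARD('k))"
  unfolding bit_weight_enum_def by (rule sum_io_weight[OF assms])

lemma hamming_weight_le_max_input_weight:
  fixes G :: "bit ^ 'n ^ 'k"
  assumes "inj (\<lambda>u. u v* G)" and v: "v \<in> inputs G d"
  shows "hamming_weight v \<le> max_input_weight G d"
proof -
  have pos: "io_weight G i d > 0 \<longleftrightarrow> (\<exists>v\<in>inputs G d. hamming_weight v = i)" for i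
    by (auto simp: io_weight_eq[OF assms(1)] card_gt_0_iff)
  have "finite {i. io_weight G i d > 0}"
    unfolding pos by (rule finite_subset[of _ "hamming_weight ` inputs G d"]) auto
  moreover have "io_weight G (hamming_weight v) d > 0"
    using v by (auto simp: pos)
  moreover have "weight_enum G d \<noteq> 0"
    using v by (auto simp: weight_enum_eq[OF assms(1)])
  ultimately show ?thesis
    by (simp add: max_input_weight_def)
qed

section \<open>List decoding\<close>

text \<open>A received value \<open>0\<close> counts as a hard error for every codeword.\<close>

definition candidates :: "bit ^ 'n ^ 'k \<Rightarrow> nat \<Rightarrow> real ^ 'n \<Rightarrow> (bit ^ 'k) set" where
  "candidates G m y = {u. card {t. bpsk (u v* G) $ t * y $ t \<le> 0} \<le> m}"

text \<open>All signals have the same norm, so maximal correlation means minimal distance.\<close>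

definition list_decode :: "bit ^ 'n ^ 'k \<Rightarrow> nat \<Rightarrow> real ^ 'n \<Rightarrow> bit ^ 'k" where
  "list_decode G m y = arg_min_on (\<lambda>u. - (bpsk (u v* G) \<bullet> y)) (candidates G m y)"

text \<open>The decoder is a fixed choice from the set \<open>A y\<close> of minimizers. That set
  takes finitely many values, each determined by finitely many measurable comparisons; an empty list
  gives a fixed arbitrary output.\<close>

lemma list_decode_measurable [measurable]: "list_decode G m \<in> borel \<rightarrow>\<^sub>M count_space UNIV"
proof -
  define A where "A y = {u. is_arg_min (\<lambda>u. - (bpsk (u v* G) \<bullet> y)) (\<lambda>u. u \<in> candidates G m y) u}" for y
  have cand: "Measurable.pred borel (\<lambda>y. u \<in> candidates G m y)" for u
  proof -
    have "card {t. bpsk (u v* G) $ t * y $ t \<le> 0} = (\<Sum>t\<in>UNIV. if bpsk (u v* G) $ t * y $ t \<le> 0 then 1 else 0)" for y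
      by (simp add: sum.If_cases)
    then show ?thesis
      unfolding candidates_def by simp
  qed
  have "A \<in> borel \<rightarrow>\<^sub>M count_space UNIV"
  proof (subst measurable_count_space_eq2, simp, safe)
    fix a
    have "A -` {a} \<inter> space borel = {y\<in>space borel. \<forall>u. (u \<in> candidates G m y \<and>
        (\<forall>u'. \<not> (u' \<in> candidates G m y \<and> - (bpsk (u' v* G) \<bullet> y) < - (bpsk (u v* G) \<bullet> y)))) = (u \<in> a)}"
      by (auto simp: A_def is_arg_min_def)
    also have "\<dots> \<in> sets borel"
      using cand by measurable
    finally show "A -` {a} \<inter> space borel \<in> sets borel" .
  qed auto
  then have "(\<lambda>y. SOME u. u \<in> A y) \<in> borel \<rightarrow>\<^sub>M count_space UNIV"
    by (rule measurable_compose) simp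
  then show ?thesis
    unfolding list_decode_def[abs_def] arg_min_on_def arg_min_def A_def by simp
qed

lemma bpsk_square: "bpsk c $ t * bpsk c $ t = 1"
  by (simp add: bpsk_def)

lemma bpsk_add:
  "bpsk (c + e) $ t = (if t \<in> support e then - bpsk c $ t else bpsk c $ t)"
  by (cases "c $ t"; cases "e $ t") (auto simp: bpsk_def support_def)

lemma list_decode_error:
  fixes G :: "bit ^ 'n ^ 'k" and u z and m :: nat
  defines "c \<equiv> u v* G"
  defines "e \<equiv> (list_decode G m (bpsk c + z) - u) v* G"
  assumes few: "card {t. 1 + bpsk c $ t * z $ t \<le> 0} \<le> m"
  shows "card (support e) \<le> 2 * m"
    and "(\<Sum>t\<in>support e. 1 + bpsk c $ t * z $ t) \<le> 0"
proof -
  let ?y = "bpsk c + z"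
  let ?v = "list_decode G m ?y"
  let ?s = "\<lambda>t. 1 + bpsk c $ t * z $ t"
  have y: "bpsk c $ t * ?y $ t = ?s t" for t
    using bpsk_square[of c t] by (simp add: distrib_left)
  have v: "?v v* G = c + e"
    using vec.linear_diff[OF linear_encode[of G], of ?v u] by (simp add: e_def c_def)
  \<comment> \<open>Passing from the transmitted to the decoded signal flips the sign exactly on
    \<open>support e\<close>.\<close>
  have vy: "bpsk (?v v* G) $ t * ?y $ t = (if t \<in> support e then - ?s t else ?s t)" for t
    using y[of t] by (simp add: v bpsk_add)
  have u: "u \<in> candidates G m ?y"
    using few y by (simp add: candidates_def c_def)
  have fin: "finite (candidates G m ?y)"
    by simp
  have "?v \<in> candidates G m ?y"
    unfolding list_decode_def using arg_min_if_finite(1)[OF fin] u by blast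
  then have "card {t. bpsk (?v v* G) $ t * ?y $ t \<le> 0} \<le> m"
    by (simp add: candidates_def)
  \<comment> \<open>Of two opposite numbers one is at most \<open>0\<close>, so each position of
    \<open>support e\<close> is a hard error for the transmitted or for the decoded codeword; each
    has at most \<open>m\<close> of them.\<close>
  moreover have "support e \<subseteq> {t. ?s t \<le> 0} \<union> {t. bpsk (?v v* G) $ t * ?y $ t \<le> 0}"
    unfolding vy by auto
  then have "card (support e) \<le> card ({t. ?s t \<le> 0} \<union> {t. bpsk (?v v* G) $ t * ?y $ t \<le> 0})"
    by (rule card_mono[rotated]) simp
  ultimately show "card (support e) \<le> 2 * m"
    using few card_Un_le[of "{t. ?s t \<le> 0}" "{t. bpsk (?v v* G) $ t * ?y $ t \<le> 0}"] by linarith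
  \<comment> \<open>The decoded signal correlates with \<open>?y\<close> at least as well as the
    transmitted one. Outside \<open>support e\<close> the terms cancel, leaving the half-space
    condition.\<close>
  have "\<not> (- (bpsk (u v* G) \<bullet> ?y) < - (bpsk (?v v* G) \<bullet> ?y))"
    unfolding list_decode_def using arg_min_if_finite(2)[OF fin, of "\<lambda>u. - (bpsk (u v* G) \<bullet> ?y)"] u by blast
  then have "(\<Sum>t\<in>UNIV. ?s t) \<le> (\<Sum>t\<in>UNIV. if t \<in> support e then - ?s t else ?s t)"
    by (simp only: inner_vec_def inner_real_def y vy c_def[symmetric] neg_less_iff_less not_less)
  also have "\<dots> = (\<Sum>t\<in>UNIV. ?s t) - 2 * (\<Sum>t\<in>support e. ?s t)"
    using sum.subset_diff[of "support e" UNIV ?s]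
    by (simp add: sum.If_cases sum_negf Compl_eq_Diff_UNIV del: minus_add_distrib)
  finally show "(\<Sum>t\<in>support e. ?s t) \<le> 0"
    by simp
qed

section \<open>From error events to the bit-error probability\<close>

lemma iid_normal_bpsk:
  assumes "\<sigma> > 0"
  shows "iid_normal (awgn \<sigma>) (\<lambda>t z. bpsk c $ t * z $ t) \<sigma>"
proof -
  interpret prob_space "awgn \<sigma> :: (real ^ 'a) measure"
    by (rule prob_space_awgn[OF assms])
  show ?thesis
  proof
    show "indep_vars (\<lambda>_. borel) (\<lambda>t z. bpsk c $ t * z $ t) UNIV"
      by (rule indep_vars_compose2[OF awgn_coordinates(1)[OF assms], where Y = "\<lambda>t x. bpsk c $ t * x"]) measurable
    show "distributed (awgn \<sigma>) lborel (\<lambda>z. bpsk c $ t * z $ t) (normal_density 0 \<sigma>)" for t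
      using normal_density_affine[OF awgn_coordinates(2)[OF assms, of t] assms, of "bpsk c $ t" 0]
      by (cases "c $ t = 0") (simp_all add: bpsk_def)
  qed fact
qed

text \<open>Each bit is charged for \<open>R\<close>, the event of too many hard errors. Otherwise a
  decoding difference \<open>v\<close> harms only the positions where it is nonzero, which gives the
  factor \<open>hamming_weight v / k\<close>. The bound does not depend on \<open>u\<close>.\<close>

lemma list_decode_bit_error:
  fixes G :: "bit ^ 'n ^ 'k"
  assumes inj: "inj (\<lambda>u. u v* G)" and "\<sigma> > 0"
  shows "(\<Sum>i\<in>UNIV. measure (awgn \<sigma>) {z. list_decode G m (bpsk (u v* G) + z) $ i \<noteq> u $ i}) / real CARD('k)
    \<le> (\<Sum>d = 1..min (2 * m) CARD('n). h' G \<sigma> m d) + B (Q (1 / \<sigma>)) (int CARD('n)) (int m + 1) (int CARD('n))"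
proof -
  let ?c = "u v* G"
  interpret iid_normal "awgn \<sigma>" "\<lambda>t z. bpsk ?c $ t * z $ t" \<sigma>
    by (rule iid_normal_bpsk[OF assms(2)])
  have sp[simp]: "space (awgn \<sigma> :: (real ^ 'n) measure) = UNIV"
    using sets_eq_imp_space_eq[OF sets_awgn] by simp
  let ?k = "real CARD('k)" and ?N = "min (2 * m) CARD('n)"
  let ?F = "{z\<in>space (awgn \<sigma>). errors UNIV z \<le> m}"
  define R where "R = {z. m < errors UNIV z}"
  define D where "D v = {z. list_decode G m (bpsk ?c + z) = u + v \<and> errors UNIV z \<le> m}" for v
  define V where "V = {v. v \<noteq> 0 \<and> hamming_weight (v v* G) \<le> 2 * m}"
  define E where "E v = pairwise_error (support (v v* G))" for v
  have dec[measurable]: "(\<lambda>z. list_decode G m (bpsk ?c + z)) \<in> borel \<rightarrow>\<^sub>M count_space UNIV"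
    by (rule measurable_compose[OF _ list_decode_measurable]) measurable
  have [measurable]: "Measurable.pred (awgn \<sigma>) (\<lambda>z. errors UNIV z \<le> m)" "Measurable.pred (awgn \<sigma>) (\<lambda>z. m < errors UNIV z)"
    by measurable
  have Rm: "R \<in> events"
    unfolding R_def by measurable
  have Dm: "D v \<in> events" for v
  proof -
    have "D v = ((\<lambda>z. list_decode G m (bpsk ?c + z)) -` {u + v} \<inter> space borel) \<inter> ?F"
      by (auto simp: D_def)
    also have "\<dots> \<in> events"
      using measurable_sets[OF dec, of "{u + v}"] by (intro sets.Int) auto
    finally show ?thesis .
  qed
  have D_dec: "hamming_weight (v v* G) \<le> 2 * m \<and> z \<in> E v" if "z \<in> D v" for z v
  proof -
    have "list_decode G m (bpsk ?c + z) - u = v"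
      using that by (simp add: D_def)
    moreover have "card {t. 1 + bpsk ?c $ t * z $ t \<le> 0} \<le> m"
      using that by (simp add: D_def errors_def)
    ultimately show ?thesis
      using list_decode_error[where G = G and u = u and z = z and m = m]
      by (simp add: E_def pairwise_error_def card_support)
  qed
  have DE: "D v \<subseteq> E v \<inter> ?F" for v
    using D_dec by (auto simp: D_def)
  have ne: "v v* G \<noteq> 0" if "v \<noteq> 0" for v
    using injD[OF inj, of v 0] that vec.linear_0[OF linear_encode[of G]] by auto
  have supp_ne: "support (v v* G) \<noteq> {}" if "v \<in> inputs G d" "d > 0" for v d
    using that card_support[of "v v* G"] by (auto simp: inputs_def)
  have R: "prob R = B (Q (1 / \<sigma>)) (int CARD('n)) (int m + 1) (int CARD('n))"
  proof -
    have "int m + 1 \<le> int (errors UNIV z) \<and> int (errors UNIV z) \<le> int CARD('n) \<longleftrightarrow> m < errors UNIV z" for z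
      using card_mono[of "UNIV :: 'n set" "{t\<in>UNIV. 1 + bpsk ?c $ t * z $ t \<le> 0}"] by (auto simp: errors_def)
    then show ?thesis
      using prob_errors_between[of UNIV "int m + 1" "int CARD('n)"] by (simp add: R_def)
  qed
  have bit: "measure (awgn \<sigma>) {z. list_decode G m (bpsk ?c + z) $ i \<noteq> u $ i}
      \<le> prob R + (\<Sum>v\<in>V. if v $ i \<noteq> 0 then prob (D v) else 0)" for i
  proof -
    have "{z. list_decode G m (bpsk ?c + z) $ i \<noteq> u $ i} \<subseteq> R \<union> (\<Union>v\<in>{v\<in>V. v $ i \<noteq> 0}. D v)"
    proof
      fix z assume z: "z \<in> {z. list_decode G m (bpsk ?c + z) $ i \<noteq> u $ i}"
      let ?v = "list_decode G m (bpsk ?c + z) - u"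
      have vi: "?v $ i \<noteq> 0"
        using z by (simp only: mem_Collect_eq vector_minus_component right_minus_eq not_False_eq_True)
      then have "?v \<noteq> 0"
        by (metis zero_index)
      show "z \<in> R \<union> (\<Union>v\<in>{v\<in>V. v $ i \<noteq> 0}. D v)"
      proof (cases "m < errors UNIV z")
        case False
        then have "z \<in> D ?v"
          by (simp add: D_def)
        then show ?thesis
          using D_dec[of z ?v] vi \<open>?v \<noteq> 0\<close> unfolding V_def by blast
      qed (simp add: R_def)
    qed
    then have "measure (awgn \<sigma>) {z. list_decode G m (bpsk ?c + z) $ i \<noteq> u $ i} \<le> prob (R \<union> (\<Union>v\<in>{v\<in>V. v $ i \<noteq> 0}. D v))"
      using Rm Dm by (intro finite_measure_mono sets.Un sets.finite_UN) auto
    also have "\<dots> \<le> prob R + prob (\<Union>v\<in>{v\<in>V. v $ i \<noteq> 0}. D v)"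
      using Rm Dm by (intro measure_Un_le sets.finite_UN) auto
    also have "prob (\<Union>v\<in>{v\<in>V. v $ i \<noteq> 0}. D v) \<le> (\<Sum>v\<in>{v\<in>V. v $ i \<noteq> 0}. prob (D v))"
      using Dm by (intro measure_UNION_le) auto
    also have "\<dots> = (\<Sum>v\<in>V. if v $ i \<noteq> 0 then prob (D v) else 0)"
      by (rule sum.inter_filter) simp
    finally show ?thesis
      by simp
  qed
  \<comment> \<open>A nonzero \<open>v\<close> has a nonzero codeword by injectivity, so the output
    weights start at \<open>1\<close>.\<close>
  have group: "(\<Sum>v\<in>V. g v) = (\<Sum>d = 1..?N. \<Sum>v\<in>inputs G d. g v)" for g :: "_ \<Rightarrow> real"
  proof -
    have "(\<Sum>v\<in>V. g v) = (\<Sum>d\<in>{1..?N}. \<Sum>v\<in>{v\<in>V. hamming_weight (v v* G) = d}. g v)"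
      using hamming_weight_pos[OF ne] hamming_weight_le
      by (intro sum.group[symmetric]) (auto simp: V_def Suc_le_eq)
    also have "\<dots> = (\<Sum>d = 1..?N. \<Sum>v\<in>inputs G d. g v)"
    proof (intro sum.cong refl)
      fix d assume "d \<in> {1..?N}"
      then show "{v\<in>V. hamming_weight (v v* G) = d} = inputs G d"
        using vec.linear_0[OF linear_encode[of G]] by (auto simp: V_def inputs_def hamming_weight_def)
    qed
    finally show ?thesis .
  qed
  have h: "(\<Sum>v\<in>inputs G d. real (hamming_weight v) / ?k * prob (D v)) \<le> h' G \<sigma> m d" if d: "d \<in> {1..?N}" for d
  proof -
    let ?q = "Q (sqrt (real d) / \<sigma>)"
    have "(\<Sum>v\<in>inputs G d. real (hamming_weight v) / ?k * prob (D v))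
        \<le> (\<Sum>v\<in>inputs G d. real (hamming_weight v) / ?k * (?q * B (Q (1 / \<sigma>)) (int CARD('n) - int d) 0 (int m - 1)))"
    proof (intro sum_mono mult_left_mono)
      fix v assume v: "v \<in> inputs G d"
      have "prob (D v) \<le> prob (E v \<inter> ?F)"
        using DE by (intro finite_measure_mono) (auto simp: E_def)
      also have "\<dots> \<le> ?q * B (Q (1 / \<sigma>)) (int CARD('n) - int d) 0 (int m - 1)"
        using prob_pairwise_error_few_errors[OF supp_ne[OF v], of m] v d
        by (simp add: E_def card_support inputs_def)
      finally show "prob (D v) \<le> ?q * B (Q (1 / \<sigma>)) (int CARD('n) - int d) 0 (int m - 1)" .
    qed simp
    also have "\<dots> = bit_weight_enum G d * ?q * B (Q (1 / \<sigma>)) (int CARD('n) - int d) 0 (int m - 1)"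
      by (simp add: bit_weight_enum_eq[OF inj] sum_distrib_right mult.assoc)
    finally have 1: "(\<Sum>v\<in>inputs G d. real (hamming_weight v) / ?k * prob (D v)) \<le> \<dots>" .
    have 2: "(\<Sum>v\<in>inputs G d. real (hamming_weight v) / ?k * prob (D v))
        \<le> real (max_input_weight G d) / ?k * ((real (weight_enum G d) - 1) * (?q - ?q\<^sup>2 / 2)
            * B (Q (1 / \<sigma>)) (int CARD('n) - 2 * int d) 0 (int m - 1) + ?q)"
    \<comment> \<open>Without codewords of weight \<open>d\<close>, the default
      \<open>max_input_weight G d = 0\<close> makes the right-hand side vanish despite the factor
      \<open>0 - 1\<close>.\<close>
    proof (cases "inputs G d = {}")
      case True
      then have "max_input_weight G d = 0"
        by (simp add: max_input_weight_def weight_enum_eq[OF inj])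
      with True show ?thesis
        by simp
    next
      case False
      have "(\<Sum>v\<in>inputs G d. real (hamming_weight v) / ?k * prob (D v))
          \<le> (\<Sum>v\<in>inputs G d. real (max_input_weight G d) / ?k * prob (D v))"
        using hamming_weight_le_max_input_weight[OF inj, of _ d]
        by (intro sum_mono mult_right_mono divide_right_mono) auto
      \<comment> \<open>The decoder has one output, so the events \<open>D v\<close> are disjoint
        and their probabilities add up to that of the union. Only then is each enlarged to a
        pairwise error event, where overlaps matter.\<close>
      also have "\<dots> = real (max_input_weight G d) / ?k * prob (\<Union>v\<in>inputs G d. D v)"
        using Dm by (subst finite_measure_finite_Union) (auto simp: sum_distrib_left disjoint_family_on_def D_def)
      also have "\<dots> \<le> real (max_input_weight G d) / ?k * prob (\<Union>v\<in>inputs G d. E v \<inter> ?F)"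
        using DE by (intro mult_left_mono finite_measure_mono sets.finite_UN) (fastforce simp: E_def)+
      also have "\<dots> \<le> real (max_input_weight G d) / ?k * ((real (weight_enum G d) - 1) * (?q - ?q\<^sup>2 / 2)
            * B (Q (1 / \<sigma>)) (int CARD('n) - 2 * int d) 0 (int m - 1) + ?q)"
      proof (intro mult_left_mono)
        have "inj_on (\<lambda>v. support (v v* G)) (inputs G d)"
          using inj by (intro inj_onI) (auto dest: support_inj injD)
        then show "prob (\<Union>v\<in>inputs G d. E v \<inter> ?F) \<le> (real (weight_enum G d) - 1) * (?q - ?q\<^sup>2 / 2)
            * B (Q (1 / \<sigma>)) (int CARD('n) - 2 * int d) 0 (int m - 1) + ?q"
          using prob_union_pairwise_errors[of "inputs G d" "\<lambda>v. support (v v* G)" d m] False d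
          by (simp add: E_def weight_enum_eq[OF inj] card_support inputs_def)
      qed simp
      finally show ?thesis .
    qed
    show ?thesis
      unfolding h'_def Let_def using 1 2 by (intro min.boundedI)
  qed
  have "(\<Sum>i\<in>UNIV. measure (awgn \<sigma>) {z. list_decode G m (bpsk ?c + z) $ i \<noteq> u $ i})
      \<le> (\<Sum>i\<in>(UNIV :: 'k set). prob R + (\<Sum>v\<in>V. if v $ i \<noteq> 0 then prob (D v) else 0))"
    by (intro sum_mono bit)
  also have "\<dots> = ?k * prob R + (\<Sum>v\<in>V. real (hamming_weight v) * prob (D v))"
    by (subst sum.distrib, subst sum.swap) (simp only: sum_hamming_weight sum_constant)
  finally have "(\<Sum>i\<in>UNIV. measure (awgn \<sigma>) {z. list_decode G m (bpsk ?c + z) $ i \<noteq> u $ i}) / ?k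
      \<le> (?k * prob R + (\<Sum>v\<in>V. real (hamming_weight v) * prob (D v))) / ?k"
    by (intro divide_right_mono) auto
  also have "\<dots> = prob R + (\<Sum>v\<in>V. real (hamming_weight v) / ?k * prob (D v))"
    by (simp add: add_divide_distrib sum_divide_distrib)
  also have "\<dots> \<le> prob R + (\<Sum>d = 1..?N. h' G \<sigma> m d)"
    unfolding group by (intro add_left_mono sum_mono h)
  finally show ?thesis
    by (simp add: R)
qed

text \<open>For a point mass the inner integrand is an indicator, so the integral is a noise
  probability. The average over \<open>u\<close> is placed outermost so that a bound for each fixed
  \<open>u\<close> can be inserted.\<close>

lemma bit_error_prob_deterministic:
  fixes G :: "bit ^ 'n ^ 'k"
  assumes "\<sigma> > 0" and f[measurable]: "f \<in> borel \<rightarrow>\<^sub>M count_space UNIV"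
  shows "(\<lambda>y. return (count_space UNIV) (f y)) \<in> decoders"
    and "bit_error_prob G \<sigma> (\<lambda>y. return (count_space UNIV) (f y)) =
      (\<Sum>u\<in>UNIV. (\<Sum>i\<in>UNIV. measure (awgn \<sigma>) {z. f (bpsk (u v* G) + z) $ i \<noteq> u $ i}) / real CARD('k))
        / real CARD(bit ^ 'k)"
proof -
  let ?D = "\<lambda>y. return (count_space UNIV) (f y)"
  show D: "?D \<in> decoders"
    unfolding decoders_def by (rule measurable_compose[OF f]) (rule measurable_return_prob_space)
  interpret N: prob_space "awgn \<sigma> :: (real ^ 'n) measure"
    by (rule prob_space_awgn[OF assms(1)])
  interpret T: prob_space "transmission G \<sigma> ?D"
    by (rule measure_transmission[OF assms(1) D])
  have "measure (transmission G \<sigma> ?D) {(u, v). v $ i \<noteq> u $ i}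
      = (\<Sum>u\<in>UNIV. 1 / real CARD(bit ^ 'k) * measure (awgn \<sigma>) {z. f (bpsk (u v* G) + z) $ i \<noteq> u $ i})" for i
  proof -
    have "(\<integral>\<^sup>+z. emeasure (?D (bpsk (u v* G) + z)) {v. v $ i \<noteq> u $ i} \<partial>awgn \<sigma>)
        = ennreal (measure (awgn \<sigma>) {z. f (bpsk (u v* G) + z) $ i \<noteq> u $ i})" for u
    proof -
      have "(\<lambda>z. f (bpsk (u v* G) + z)) \<in> borel \<rightarrow>\<^sub>M count_space UNIV"
        by (rule measurable_compose[OF _ f]) measurable
      from measurable_sets[OF this, of "{v. v $ i \<noteq> u $ i}"]
      have "{z. f (bpsk (u v* G) + z) $ i \<noteq> u $ i} \<in> sets (awgn \<sigma>)"
        by (simp add: vimage_def)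
      moreover have "(\<integral>\<^sup>+z. emeasure (?D (bpsk (u v* G) + z)) {v. v $ i \<noteq> u $ i} \<partial>awgn \<sigma>)
          = (\<integral>\<^sup>+z. indicator {z. f (bpsk (u v* G) + z) $ i \<noteq> u $ i} z \<partial>awgn \<sigma>)"
        by (intro nn_integral_cong) (simp add: indicator_def)
      ultimately show ?thesis
        by (simp add: N.emeasure_eq_measure)
    qed
    then have "ennreal (measure (transmission G \<sigma> ?D) {(u, v). v $ i \<noteq> u $ i})
      = (\<Sum>u\<in>UNIV. ennreal (1 / real CARD(bit ^ 'k) * measure (awgn \<sigma>) {z. f (bpsk (u v* G) + z) $ i \<noteq> u $ i}))"
      using measure_transmission(3)[OF assms(1) D, of G "{(u, v). v $ i \<noteq> u $ i}"]
      by (simp add: T.emeasure_eq_measure flip: ennreal_mult)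
    also have "\<dots> = ennreal (\<Sum>u\<in>UNIV. 1 / real CARD(bit ^ 'k) * measure (awgn \<sigma>) {z. f (bpsk (u v* G) + z) $ i \<noteq> u $ i})"
      by (rule sum_ennreal) simp
    finally show ?thesis
      by (simp add: sum_nonneg)
  qed
  then have "bit_error_prob G \<sigma> ?D = (\<Sum>i\<in>(UNIV :: 'k set). \<Sum>u\<in>(UNIV :: (bit ^ 'k) set).
      1 / real CARD(bit ^ 'k) * measure (awgn \<sigma>) {z. f (bpsk (u v* G) + z) $ i \<noteq> u $ i}) / real CARD('k)"
    by (simp only: bit_error_prob_def)
  also have "\<dots> = (\<Sum>u\<in>(UNIV :: (bit ^ 'k) set). \<Sum>i\<in>(UNIV :: 'k set).
      measure (awgn \<sigma>) {z. f (bpsk (u v* G) + z) $ i \<noteq> u $ i} / real CARD('k) / real CARD(bit ^ 'k))"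
    by (subst sum.swap) (simp only: sum_divide_distrib mult_1 times_divide_eq_left divide_divide_eq_left mult.commute)
  finally show "bit_error_prob G \<sigma> ?D =
      (\<Sum>u\<in>UNIV. (\<Sum>i\<in>UNIV. measure (awgn \<sigma>) {z. f (bpsk (u v* G) + z) $ i \<noteq> u $ i}) / real CARD('k))
        / real CARD(bit ^ 'k)"
    by (simp only: sum_divide_distrib)
qed

theorem theorem6:
  fixes G :: "bit ^ 'n ^ 'k" and \<sigma> :: real
  assumes "vec.dim (code G) = CARD('k)"
    and "\<sigma> > 0"
  shows "min_bit_error_prob G \<sigma> \<le>
    (MIN ds\<in>{0..CARD('n)}.
       (\<Sum>d = 1..min (2 * ds) CARD('n). h' G \<sigma> ds d)
       + B (Q (1 / \<sigma>)) (int CARD('n)) (int ds + 1) (int CARD('n)))"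
proof -
  let ?b = "\<lambda>m. (\<Sum>d = 1..min (2 * m) CARD('n). h' G \<sigma> m d) + B (Q (1 / \<sigma>)) (int CARD('n)) (int m + 1) (int CARD('n))"
  have "min_bit_error_prob G \<sigma> \<le> ?b m" for m
  proof -
    let ?D = "\<lambda>y. return (count_space UNIV) (list_decode G m y)"
    \<comment> \<open>Attainment of the infimum gives the comparison with any particular
      decoder.\<close>
    have "min_bit_error_prob G \<sigma> \<le> bit_error_prob G \<sigma> ?D"
      using min_bit_error_prob_attained[OF assms(2), of G]
        bit_error_prob_deterministic(1)[OF assms(2) list_decode_measurable, of G m] by force
    also have "\<dots> \<le> (\<Sum>u\<in>(UNIV :: (bit ^ 'k) set). ?b m) / real CARD(bit ^ 'k)"
      unfolding bit_error_prob_deterministic(2)[OF assms(2) list_decode_measurable]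
      by (intro divide_right_mono sum_mono list_decode_bit_error inj_encode assms) simp
    also have "\<dots> = ?b m"
      by simp
    finally show ?thesis .
  qed
  then show ?thesis
    by (intro Min.boundedI) auto
qed

end
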